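(* Let $\mathscr{E}=\{E_1|H_1,\ldots,E_n|H_n\}$ be a family of $n$ conditional events, with all previsions involved coherently assessed. For each subset $\{i_1,\ldots,i_h\}\subseteq\{1,\ldots,n\}$, with $\{i_{h+1},\ldots,i_n\}=\{1,\ldots,n\}\setminus\{i_1,\ldots,i_h\}$, let \[ \mathscr{C}_{i_1\cdots i_h\overline{i_{h+1}}\cdots\overline{i_n}}=(E_{i_1}|H_{i_1})\wedge\cdots\wedge(E_{i_h}|H_{i_h})\wedge(\overline{E}_{i_{h+1}}|H_{i_{h+1}})\wedge\cdots\wedge(\overline{E}_{i_n}|H_{i_n}) \] (those that are not identically $0$ are the conditional constituents associated with $\mathscr{E}$). Then for all subsets $\{i_1,\ldots,i_h\}\neq\{j_1,\ldots,j_k\}$ of $\{1,\ldots,n\}$, \[ \mathscr{C}_{i_1\cdots i_h\overline{i_{h+1}}\cdots\overline{i_n}}\wedge\mathscr{C}_{j_1\cdots j_k\overline{j_{k+1}}\cdots\overline{j_n}}=\emptyset|(H_1\vee\cdots\vee H_n)=0, \] where $\{j_{k+1},\ldots,j_n\}=\{1,\ldots,n\}\setminus\{j_1,\ldots,j_k\}$.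
   Context: Events. Events are elements of a Boolean algebra with top $\Omega$ (sure event) and bottom $\emptyset$ (impossible event); one may take subsets of a set $\Omega$. An event is identified with its $0/1$ indicator; $EF$ or $E\wedge F$ is conjunction, $E\vee F$ disjunction, $\overline{E}$ negation. Conditional random quantities. Given an event $H\neq\emptyset$, a random quantity $X$ (a real-valued function on $\Omega$ with finitely many values on $H$) and an assessed real number $\mu=\mathbb{P}(X|H)$ (the conditional prevision), the conditional random quantity $X|H$ is $XH+\mu\overline{H}$ (value $X$ if $H$ is true, $\mu$ if $H$ is false). For a conditional event $E|H$ with $P(E|H)=x$, its indicator (same symbol) is $E|H=EH+x\overline{H}$; it is true, false or void when $EH$, $\overline{E}H$ or $\overline{H}$ is true, respectively. Coherence. A prevision assessment on a family of conditional random quantities is coherent if for every finite subfamily $X_1|H_1,\ldots,X_m|H_m$ with assessed previsions $\mu_1,\ldots,\mu_m$ and all real $s_1,\ldots,s_m$, the random gain $G=\sum_{i=1}^m s_iH_i(X_i-\mu_i)$, restricted to $H_1\vee\cdots\vee H_m$, satisfies $\min G\le 0\le\max G$. Conjunction. For a finite family $(A_i|K_i)_{i\in T}$ of conditional events, the conjunctions $\mathscr{C}_S=\bigwedge_{i\in S}(A_i|K_i)$, $\emptyset\ne S\subseteq T$, with assessed previsions $x_S=\mathbb{P}(\mathscr{C}_S)$, are defined recursively on $|S|$ by \[ \mathscr{C}_S=\Big[\bigwedge_{i\in S}A_iK_i+\sum_{\emptyset\neq R\subsetneq S}x_R\Big(\bigwedge_{i\in R}\overline{K}_i\Big)\wedge\Big(\bigwedge_{i\in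 S\setminus R}A_iK_i\Big)\Big]\Big|\Big(\bigvee_{i\in S}K_i\Big), \] i.e. $\mathscr{C}_S$ has value $1$ if all $A_iK_i$ ($i\in S$) are true; $0$ if some $\overline{A}_iK_i$ is true; $x_R$ if exactly the conditional events with index in $R$ are void and the others are true ($\emptyset\ne R\subsetneq S$); $x_S$ if all $K_i$, $i\in S$, are false. For $S=\{i\}$, $\mathscr{C}_S=A_i|K_i$. The conjunction of two conjunctions is the conjunction of the union of the two underlying families of conditional events: $\mathscr{C}(\mathscr{E}')\wedge\mathscr{C}(\mathscr{E}'')=\mathscr{C}(\mathscr{E}'\cup\mathscr{E}'')$. Standing assumption. The previsions assessed for all conditional events $E_i|H_i$, $\overline{E}_i|H_i$ and all the conjunctions and sub-conjunctions of them involved form a coherent assessment. Equality of conditional random quantities means equality of values in all cases (as functions on $\Omega$). *)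

theory Defs
  imports Complex_Main "HOL-Library.Indicator_Function"
begin

text \<open>Events are subsets of a sample space \<open>\<Omega>\<close>, which is the type of outcomes \<open>'w\<close>.
  A conditional random quantity \<open>X|H\<close> carries its assessed prevision.\<close>

datatype 'w crq =
  CRQ (quantity: "'w \<Rightarrow> real") (given: "'w set") (prevision: real)

definition is_crq :: "'w crq \<Rightarrow> bool" where
  "is_crq c \<longleftrightarrow> given c \<noteq> {} \<and> finite (quantity c ` given c)"

definition crq_value :: "'w crq \<Rightarrow> 'w \<Rightarrow> real" where
  "crq_value c = (\<lambda>w. quantity c w * indicator (given c) w + prevision c * indicator (- given c) w)"

definition cond_event :: "'w set \<Rightarrow> 'w set \<Rightarrow> real \<Rightarrow> 'w crq" where
  "cond_event E H p = CRQ (indicator E) H p"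

definition gain :: "'w crq set \<Rightarrow> ('w crq \<Rightarrow> real) \<Rightarrow> 'w \<Rightarrow> real" where
  "gain F s = (\<lambda>w. \<Sum>c\<in>F. s c * indicator (given c) w * (quantity c w - prevision c))"

text \<open>The set over which \<open>Min\<close> and \<open>Max\<close> are taken is finite and nonempty because of \<open>is_crq\<close>.\<close>

definition coherent :: "'w crq set \<Rightarrow> bool" where
  "coherent \<A> \<longleftrightarrow>
     (\<forall>c\<in>\<A>. is_crq c) \<and>
     (\<forall>F s. finite F \<and> F \<noteq> {} \<and> F \<subseteq> \<A> \<longrightarrow>
        Min (gain F s ` (\<Union>c\<in>F. given c)) \<le> 0 \<and>
        0 \<le> Max (gain F s ` (\<Union>c\<in>F. given c)))"

text \<open>For a family of conditional events \<open>A i|K i\<close> and \<open>x S\<close> the prevision assessed for the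
  conjunction of the subfamily indexed by \<open>S\<close>. The recursion of the definition is only in the
  meaning of \<open>x\<close>: the conjunction over \<open>S\<close> depends on the smaller ones through their previsions.\<close>

definition conjunction ::
  "('i \<Rightarrow> 'w set) \<Rightarrow> ('i \<Rightarrow> 'w set) \<Rightarrow> ('i set \<Rightarrow> real) \<Rightarrow> 'i set \<Rightarrow> 'w crq" where
  "conjunction A K x S =
     CRQ (\<lambda>w. indicator (\<Inter>i\<in>S. A i \<inter> K i) w +
              (\<Sum>R | R \<noteq> {} \<and> R \<subset> S.
                 x R * indicator ((\<Inter>i\<in>R. - K i) \<inter> (\<Inter>i\<in>S - R. A i \<inter> K i)) w))
         (\<Union>i\<in>S. K i)
         (x S)"

text \<open>The conjunction of the conjunctions over the subfamilies \<open>S\<close> and \<open>S'\<close>.\<close>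

definition conj_of_conjs ::
  "('i \<Rightarrow> 'w set) \<Rightarrow> ('i \<Rightarrow> 'w set) \<Rightarrow> ('i set \<Rightarrow> real) \<Rightarrow> 'i set \<Rightarrow> 'i set \<Rightarrow> 'w crq" where
  "conj_of_conjs A K x S S' = conjunction A K x (S \<union> S')"

text \<open>The conditional events \<open>E i|H i\<close> and \<open>- E i|H i\<close> form one family, indexed by \<open>(i, True)\<close>
  and \<open>(i, False)\<close> respectively.\<close>

definition lit_event :: "(nat \<Rightarrow> 'w set) \<Rightarrow> nat \<times> bool \<Rightarrow> 'w set" where
  "lit_event E = (\<lambda>(i, b). if b then E i else - E i)"

definition lit_given :: "(nat \<Rightarrow> 'w set) \<Rightarrow> nat \<times> bool \<Rightarrow> 'w set" where
  "lit_given H = (\<lambda>(i, b). H i)"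

text \<open>The subfamily whose conjunction has \<open>E i|H i\<close> for \<open>i \<in> I\<close> and \<open>- E i|H i\<close> for the other \<open>i\<close>.\<close>

definition constituent_lits :: "nat \<Rightarrow> nat set \<Rightarrow> (nat \<times> bool) set" where
  "constituent_lits n I = I \<times> {True} \<union> ({1..n} - I) \<times> {False}"

end

theory Submission
  imports Defs
begin

text \<open>If \<open>I \<noteq> J\<close>, some index \<open>k\<close> lies in exactly one of the two sets, so the conjunction of the
  two constituents is taken over a family that contains both \<open>E k|H k\<close> and \<open>- E k|H k\<close>. These two
  conditional events are void together and are never true together. Hence any conjunction that
  contains both vanishes when \<open>H k\<close> holds, and when \<open>H k\<close> fails its value is either \<open>0\<close> or
  the prevision of a conjunction that again contains both. The whole matter is therefore to see that
  every such prevision is \<open>0\<close>. This follows by induction on the size of the family: once the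
  smaller previsions are \<open>0\<close>, the conjunction is constantly \<open>0\<close> on its conditioning event, and a
  coherent prevision of a conditionally constant quantity must be that constant
  (\<open>coherent_prevision_const\<close>), by betting on it alone. The induction is
  \<open>prevision_conjunction_incompatible\<close>. The same remark about constants gives \<open>p = 0\<close> for the impossible
  event given \<open>H 1 \<or> \<dots> \<or> H n\<close>.\<close>

text \<open>The gain of the unit bet on \<open>c\<close> alone is constantly \<open>a - prevision c\<close>, so its minimum and its
  maximum coincide and both sign conditions bear on the same number.\<close>

lemma coherent_prevision_const:
  assumes "coherent \<A>" and "c \<in> \<A>"
    and const: "\<And>w. w \<in> given c \<Longrightarrow> quantity c w = a"
  shows "prevision c = a"
proof -
  have ne: "given c \<noteq> {}"
    using assms(1,2) by (auto simp: coherent_def is_crq_def)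
  have "gain {c} (\<lambda>_. 1) ` given c = (\<lambda>_. a - prevision c) ` given c"
    by (rule image_cong) (auto simp: gain_def const)
  also have "\<dots> = {a - prevision c}"
    using ne by auto
  finally have gains: "gain {c} (\<lambda>_. 1) ` (\<Union>c'\<in>{c}. given c') = {a - prevision c}"
    by simp
  have "Min (gain {c} (\<lambda>_. 1) ` (\<Union>c'\<in>{c}. given c')) \<le> 0 \<and>
        0 \<le> Max (gain {c} (\<lambda>_. 1) ` (\<Union>c'\<in>{c}. given c'))"
    using assms(1,2) unfolding coherent_def by blast
  then show ?thesis
    unfolding gains by simp
qed

text \<open>In the sum that defines the conjunction, a set \<open>R\<close> of void members contributes only if it
  contains both of \<open>k\<close> and \<open>l\<close>: they are void together, and outside \<open>R\<close> they would have to be true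
  together. The hypothesis on \<open>x\<close> removes the remaining sets \<open>R\<close>.\<close>

lemma quantity_conjunction_incompatible:
  assumes "k \<in> S" and "l \<in> S" and "K k = K l" and "A k \<inter> A l \<inter> K k = {}"
    and smaller: "\<And>R. R \<subset> S \<Longrightarrow> k \<in> R \<Longrightarrow> l \<in> R \<Longrightarrow> x R = 0"
  shows "quantity (conjunction A K x S) w = 0"
proof -
  have summand: "x R * indicator ((\<Inter>i\<in>R. - K i) \<inter> (\<Inter>i\<in>S - R. A i \<inter> K i)) w = 0" if "R \<subset> S" for R
  proof (cases "k \<in> R \<and> l \<in> R")
    case True
    then show ?thesis using smaller that by simp
  next
    case False
    then have "w \<notin> (\<Inter>i\<in>R. - K i) \<inter> (\<Inter>i\<in>S - R. A i \<inter> K i)"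
      using assms(1-4) by blast
    then show ?thesis by simp
  qed
  have "(\<Sum>R | R \<noteq> {} \<and> R \<subset> S.
      x R * indicator ((\<Inter>i\<in>R. - K i) \<inter> (\<Inter>i\<in>S - R. A i \<inter> K i)) w) = 0"
    by (rule sum.neutral) (use summand in blast)
  moreover have "w \<notin> (\<Inter>i\<in>S. A i \<inter> K i)"
    using assms(1-4) by blast
  ultimately show ?thesis
    unfolding conjunction_def crq.sel by simp
qed

text \<open>The induction is on the finite set \<open>S\<close> along proper subsets: the value of the conjunction on its conditioning
  event involves only the previsions of its proper sub-conjunctions, and coherence then fixes \<open>x S\<close>.\<close>

lemma prevision_conjunction_incompatible:
  assumes coh: "coherent \<A>"
    and family: "\<And>S. S \<noteq> {} \<Longrightarrow> S \<subseteq> T \<Longrightarrow> conjunction A K x S \<in> \<A>"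
    and "K k = K l" and "A k \<inter> A l \<inter> K k = {}"
    and "finite S" and "S \<subseteq> T" and "k \<in> S" and "l \<in> S"
  shows "x S = 0"
  using assms(5-8)
proof (induction S rule: finite_psubset_induct)
  case (psubset S)
  have "x R = 0" if "R \<subset> S" "k \<in> R" "l \<in> R" for R
    using psubset.IH[OF that(1)] psubset.prems(1) that by blast
  then have "quantity (conjunction A K x S) w = 0" for w
    by (rule quantity_conjunction_incompatible[OF psubset.prems(2,3) assms(3,4)])
  moreover have "conjunction A K x S \<in> \<A>"
    using family psubset.prems by blast
  ultimately have "prevision (conjunction A K x S) = 0"
    using coherent_prevision_const[OF coh] by blast
  then show ?case
    by (simp add: conjunction_def)
qed

lemma conjunction_incompatible:
  assumes coh: "coherent \<A>"
    and family: "\<And>S. S \<noteq> {} \<Longrightarrow> S \<subseteq> T \<Longrightarrow> conjunction A K x S \<in> \<A>"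
    and "K k = K l" and "A k \<inter> A l \<inter> K k = {}"
    and "finite S" and "S \<subseteq> T" and "k \<in> S" and "l \<in> S"
  shows "crq_value (conjunction A K x S) = (\<lambda>w. 0)"
proof -
  have void: "x R = 0" if "R \<subseteq> S" "k \<in> R" "l \<in> R" for R
    using prevision_conjunction_incompatible[OF coh family assms(3,4)
        finite_subset[OF that(1) assms(5)] subset_trans[OF that(1) assms(6)] that(2,3)] .
  have "quantity (conjunction A K x S) w = 0" for w
    by (rule quantity_conjunction_incompatible[OF assms(7,8,3,4)]) (rule void, simp_all)
  moreover have "prevision (conjunction A K x S) = 0"
    using void[of S] assms(7,8) by (simp add: conjunction_def)
  ultimately show ?thesis
    by (simp add: crq_value_def)
qed

theorem theorem9:
  fixes n :: nat
    and E H :: "nat \<Rightarrow> 'w set"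
    and x :: "(nat \<times> bool) set \<Rightarrow> real"
    and p :: real
    and I J :: "nat set"
  assumes nonempty: "\<And>i. i \<in> {1..n} \<Longrightarrow> H i \<noteq> {}"
    and coherent: "coherent
          (insert (cond_event {} (\<Union>i\<in>{1..n}. H i) p)
            {conjunction (lit_event E) (lit_given H) x S | S. S \<noteq> {} \<and> S \<subseteq> {1..n} \<times> UNIV})"
    and "I \<subseteq> {1..n}" and "J \<subseteq> {1..n}" and "I \<noteq> J"
  shows "crq_value (conj_of_conjs (lit_event E) (lit_given H) x
             (constituent_lits n I) (constituent_lits n J))
           = crq_value (cond_event {} (\<Union>i\<in>{1..n}. H i) p)
         \<and> crq_value (cond_event {} (\<Union>i\<in>{1..n}. H i) p) = (\<lambda>w. 0)"
proof -
  let ?S = "constituent_lits n I \<union> constituent_lits n J"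
  let ?c = "cond_event {} (\<Union>i\<in>{1..n}. H i) p"
  obtain k where k: "(k, True) \<in> ?S" "(k, False) \<in> ?S"
    using assms(3-5) unfolding constituent_lits_def by blast
  have sub: "?S \<subseteq> {1..n} \<times> UNIV"
    using assms(3,4) unfolding constituent_lits_def by blast
  then have fin: "finite ?S"
    by (rule finite_subset) simp
  have "crq_value (conjunction (lit_event E) (lit_given H) x ?S) = (\<lambda>w. 0)"
  proof (rule conjunction_incompatible[OF coherent _ _ _ fin sub k])
    fix S :: "(nat \<times> bool) set"
    assume "S \<noteq> {}" and "S \<subseteq> {1..n} \<times> UNIV"
    then show "conjunction (lit_event E) (lit_given H) x S \<in>
        insert ?c {conjunction (lit_event E) (lit_given H) x S | S.
          S \<noteq> {} \<and> S \<subseteq> {1..n} \<times> UNIV}"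
      by blast
  qed (simp_all add: lit_event_def lit_given_def)
  moreover have "prevision ?c = 0"
    using coherent by (rule coherent_prevision_const) (simp_all add: cond_event_def)
  then have "crq_value ?c = (\<lambda>w. 0)"
    by (simp add: crq_value_def cond_event_def)
  ultimately show ?thesis
    by (simp add: conj_of_conjs_def)
qed

end
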